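(* Let $n\ge 1$ and $k\ge 0$ be integers. (i) The number of Dyck $n$-paths containing exactly $k$ occurrences of $UDU$ (as contiguous substrings) is $\binom{n-1}{k}M_{n-1-k}$. (ii) The number of Dyck $n$-paths containing exactly $k$ occurrences of $DDU$ (as contiguous substrings) is $\binom{n-1}{2k}2^{n-1-2k}C_k$.
   Context: A Motzkin $n$-path is a lattice path consisting of $n$ steps, each an upstep $U=(1,1)$, a flatstep $F=(1,0)$ or a downstep $D=(1,-1)$, with equally many $U$s and $D$s, that never goes below the horizontal line through its initial and terminal points. The Motzkin number $M_m$ is the number of Motzkin $m$-paths (with $M_m=0$ for $m<0$). A Dyck $n$-path is a Motzkin $(2n)$-path with no flatsteps; paths are identified with words in $U,F,D$. $C_k=\frac{1}{k+1}\binom{2k}{k}$ is the $k$-th Catalan number, and $\binom{a}{b}=0$ when $b>a$. *)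

theory Defs
  imports Complex_Main
begin

datatype step = U | F | D

primrec rise :: "step \<Rightarrow> int" where
  "rise U = 1"
| "rise F = 0"
| "rise D = -1"

definition height :: "step list \<Rightarrow> int" where
  "height w = sum_list (map rise w)"

text \<open>Paths start at the origin, so the horizontal line through the initial and
  terminal points is at height 0.\<close>

definition motzkin_path :: "nat \<Rightarrow> step list \<Rightarrow> bool" where
  "motzkin_path n w \<longleftrightarrow>
     length w = n \<and> count_list w U = count_list w D \<and> (\<forall>i\<le>n. 0 \<le> height (take i w))"

definition dyck_path :: "nat \<Rightarrow> step list \<Rightarrow> bool" where
  "dyck_path n w \<longleftrightarrow> motzkin_path (2 * n) w \<and> F \<notin> set w"

definition motzkin_number :: "int \<Rightarrow> nat" where
  "motzkin_number m = (if m < 0 then 0 else card {w. motzkin_path (nat m) w})"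

definition catalan :: "nat \<Rightarrow> nat" where
  "catalan k = ((2 * k) choose k) div (k + 1)"

text \<open>The division in the definition of the Catalan numbers is exact.\<close>

lemma Suc_times_catalan: "(k + 1) * catalan k = (2 * k) choose k"
proof (cases k)
  case 0
  then show ?thesis by (simp add: catalan_def)
next
  case (Suc j)
  have "Suc j * ((2 * k) choose Suc j) = (2 * k - j) * ((2 * k) choose j)"
    using binomial_absorb_comp[of "2 * k" j] binomial_absorption[of j "2 * k - 1"] Suc
    by (metis binomial_absorption diff_Suc_1 mult_Suc_right add_Suc)
  then have "k * ((2 * k) choose k) = (k + 1) * ((2 * k) choose j)"
    using Suc by simp
  then have "(k + 1) dvd k * ((2 * k) choose k)" by (metis dvd_triv_left)
  moreover have "coprime (k + 1) k" by simp
  ultimately have "(k + 1) dvd ((2 * k) choose k)"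
    using coprime_dvd_mult_right_iff by blast
  then show ?thesis by (simp only: catalan_def dvd_mult_div_cancel)
qed

text \<open>Occurrences are counted by starting position, so overlapping ones all count.\<close>

definition occurrences :: "'a list \<Rightarrow> 'a list \<Rightarrow> nat" where
  "occurrences p w =
     card {i. i + length p \<le> length w \<and> take (length p) (drop i w) = p}"

end

theory Submission
  imports Defs
begin

text \<open>Split a nonempty Dyck path at its first return as U A D B. Distinguishing which of A and B
  are empty gives four shapes, so nonempty Dyck n-paths correspond to unary-binary trees with n
  nodes and two kinds of unary nodes. A UDU arises exactly where A is empty and B is not, a DDU
  exactly where both are nonempty. The same trees encode Motzkin (n-1)-paths with two colours of
  flatsteps, where these statistics become the number of flatsteps of the first colour and the
  number of upsteps. Erasing the flatsteps of one colour (resp. all of them) and choosing their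
  positions (and colours) leaves an arbitrary Motzkin path (resp. Dyck path).\<close>

section \<open>Words that stay above a level\<close>

abbreviation weight :: "('a \<Rightarrow> int) \<Rightarrow> 'a list \<Rightarrow> int" where
  "weight r w \<equiv> sum_list (map r w)"

text \<open>The starting height is a parameter so that inductions along the word go through. The
  weight function \<open>r\<close> is arbitrary because two alphabets occur, \<open>step\<close> and
  \<open>step option\<close>.\<close>

fun stays_from :: "('a \<Rightarrow> int) \<Rightarrow> int \<Rightarrow> 'a list \<Rightarrow> bool" where
  "stays_from r h [] \<longleftrightarrow> 0 \<le> h"
| "stays_from r h (x # w) \<longleftrightarrow> 0 \<le> h \<and> stays_from r (h + r x) w"

definition balanced :: "('a \<Rightarrow> int) \<Rightarrow> 'a list \<Rightarrow> bool" where
  "balanced r w \<longleftrightarrow> stays_from r 0 w \<and> weight r w = 0"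

lemma stays_from_nonneg: "stays_from r h w \<Longrightarrow> 0 \<le> h"
  by (cases w) auto

lemma stays_from_iff_take:
  "stays_from r h w \<longleftrightarrow> (\<forall>i\<le>length w. 0 \<le> h + weight r (take i w))"
proof (induction w arbitrary: h)
  case Nil
  then show ?case by simp
next
  case (Cons x w)
  have split: "(\<forall>i\<le>Suc m. Q i) \<longleftrightarrow> Q 0 \<and> (\<forall>i\<le>m. Q (Suc i))" for m Q
    by (metis Suc_le_mono not0_implies_Suc zero_le)
  show ?case by (simp add: split Cons.IH add.assoc)
qed

lemma stays_from_append:
  "stays_from r h (u @ v) \<longleftrightarrow> stays_from r h u \<and> stays_from r (h + weight r u) v"
  by (induction u arbitrary: h) (auto simp: add.assoc dest: stays_from_nonneg)

lemma stays_from_mono: "stays_from r h w \<Longrightarrow> h \<le> h' \<Longrightarrow> stays_from r h' w"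
  by (induction w arbitrary: h h') auto

lemma stays_from_map: "stays_from r h (map f w) \<longleftrightarrow> stays_from (r \<circ> f) h w"
  by (induction w arbitrary: h) auto

text \<open>Deleting letters of weight 0 only removes repetitions from the sequence of heights. This
  is what makes erasing flatsteps harmless.\<close>

lemma stays_from_filter:
  assumes "\<And>x. \<not> P x \<Longrightarrow> r x = 0"
  shows "stays_from r h (filter P w) \<longleftrightarrow> stays_from r h w"
  by (induction w arbitrary: h) (auto simp: assms dest: stays_from_nonneg)

lemma weight_filter:
  assumes "\<And>x. \<not> P x \<Longrightarrow> r x = 0"
  shows "weight r (filter P w) = weight r w"
  by (induction w) (auto simp: assms)

lemma balanced_map: "balanced r (map f w) \<longleftrightarrow> balanced (r \<circ> f) w"
  by (simp add: balanced_def stays_from_map)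

lemma balanced_filter:
  assumes "\<And>x. \<not> P x \<Longrightarrow> r x = 0"
  shows "balanced r (filter P w) \<longleftrightarrow> balanced r w"
  by (simp add: balanced_def stays_from_filter weight_filter assms)

lemma balanced_Nil [simp]: "balanced r []"
  by (simp add: balanced_def)

lemma balanced_Cons_flat: "r x = 0 \<Longrightarrow> balanced r (x # w) \<longleftrightarrow> balanced r w"
  by (simp add: balanced_def)

lemma balanced_first_return:
  assumes "balanced r A" "balanced r B" "r u = 1" "r d = -1"
  shows "balanced r (u # A @ d # B)"
  using assms by (auto simp: balanced_def stays_from_append intro: stays_from_mono)

text \<open>A path that falls by at most 1 per step cannot jump over a level, so the first step
  below 0 goes from height exactly 0 to -1.\<close>

lemma first_passage:
  assumes "\<And>x. -1 \<le> r x" "0 \<le> h" "h + weight r w = -1"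
  shows "\<exists>A d B. w = A @ d # B \<and> stays_from r h A \<and> h + weight r A = 0 \<and> r d = -1"
  using assms(2,3)
proof (induction w arbitrary: h)
  case Nil
  then show ?case by simp
next
  case (Cons x w)
  show ?case
  proof (cases "h + r x < 0")
    case True
    then have "h = 0" "r x = -1" using assms(1)[of x] Cons.prems by auto
    then show ?thesis by (intro exI[of _ "[]"]) auto
  next
    case False
    then obtain A d B where "w = A @ d # B" "stays_from r (h + r x) A"
      "h + r x + weight r A = 0" "r d = -1"
      using Cons.IH[of "h + r x"] Cons.prems by (auto simp: add.assoc)
    then show ?thesis using Cons.prems
      by (intro exI[of _ "x # A"] exI[of _ d] exI[of _ B]) auto
  qed
qed

text \<open>After \<open>u\<close> the word \<open>w\<close> has total weight -1, so its first
  passage to -1 is the step \<open>d\<close> of the first return; what follows \<open>d\<close>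
  again starts at height 0.\<close>

lemma balanced_first_return_exists:
  assumes "\<And>x. -1 \<le> r x" "balanced r (u # w)" "r u = 1"
  obtains A d B where "w = A @ d # B" "balanced r A" "r d = -1" "balanced r B"
proof -
  obtain A d B where *: "w = A @ d # B" "stays_from r 0 A" "weight r A = 0" "r d = -1"
    using first_passage[of r 0 w] assms by (auto simp: balanced_def)
  moreover from * have "balanced r A" "balanced r B"
    using assms by (auto simp: balanced_def stays_from_append)
  ultimately show thesis using that by blast
qed

text \<open>If one of \<open>A\<close>, \<open>A'\<close> were longer, it would contain the other
  one followed by its down step, and so reach height -1.\<close>

lemma first_passage_unique:
  assumes "A @ d # B = A' @ d' # B'" "stays_from r h A" "stays_from r h A'"
    "h + weight r A = 0" "h + weight r A' = 0" "r d = -1" "r d' = -1"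
  shows "A = A'"
  using assms
proof (induction A arbitrary: A' h)
  case Nil
  then show ?case by (cases A') (auto dest: stays_from_nonneg)
next
  case (Cons x A)
  show ?case
  proof (cases A')
    case Nil
    then show ?thesis using Cons.prems by (auto dest: stays_from_nonneg)
  next
    case (Cons y A'')
    then show ?thesis using Cons.prems Cons.IH[of A'' "h + r x"] by (auto simp: add.assoc)
  qed
qed

lemma first_return_eq_iff:
  assumes "balanced r A" "balanced r A'" "r d = -1"
  shows "A @ d # B = A' @ d # B' \<longleftrightarrow> A = A' \<and> B = B'"
  using first_passage_unique[of A d B A' d B' r 0] assms by (auto simp: balanced_def)

section \<open>Motzkin and Dyck paths as balanced words\<close>

lemma weight_rise: "weight rise w = int (count_list w U) - int (count_list w D)"
proof (induction w)
  case (Cons x w)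
  then show ?case by (cases x) auto
qed simp

lemma motzkin_path_iff: "motzkin_path n w \<longleftrightarrow> length w = n \<and> balanced rise w"
  by (auto simp: motzkin_path_def balanced_def stays_from_iff_take height_def weight_rise)

lemma dyck_path_iff: "dyck_path n w \<longleftrightarrow> length w = 2 * n \<and> balanced rise w \<and> F \<notin> set w"
  by (auto simp: dyck_path_def motzkin_path_iff)

section \<open>Unary-binary trees\<close>

text \<open>For a path split as \<open>U # A @ D # B\<close>: \<open>Leaf\<close> stands for
  \<open>A\<close> and \<open>B\<close> empty, \<open>Left\<close> for only \<open>A\<close> empty,
  \<open>Right\<close> for only \<open>B\<close> empty, \<open>Bin\<close> for neither
  empty.\<close>

datatype ubtree = Leaf | Left ubtree | Right ubtree | Bin ubtree ubtree

primrec nodes :: "ubtree \<Rightarrow> nat" where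
  "nodes Leaf = 1"
| "nodes (Left t) = Suc (nodes t)"
| "nodes (Right t) = Suc (nodes t)"
| "nodes (Bin s t) = Suc (nodes s + nodes t)"

primrec lefts :: "ubtree \<Rightarrow> nat" where
  "lefts Leaf = 0"
| "lefts (Left t) = Suc (lefts t)"
| "lefts (Right t) = lefts t"
| "lefts (Bin s t) = lefts s + lefts t"

primrec bins :: "ubtree \<Rightarrow> nat" where
  "bins Leaf = 0"
| "bins (Left t) = bins t"
| "bins (Right t) = bins t"
| "bins (Bin s t) = Suc (bins s + bins t)"

primrec dyck_of :: "ubtree \<Rightarrow> step list" where
  "dyck_of Leaf = [U, D]"
| "dyck_of (Left t) = U # D # dyck_of t"
| "dyck_of (Right t) = U # dyck_of t @ [D]"
| "dyck_of (Bin s t) = U # dyck_of s @ D # dyck_of t"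

text \<open>The letter \<^term>\<open>None\<close> is a flatstep of the first colour.\<close>

primrec motzkin_of :: "ubtree \<Rightarrow> step option list" where
  "motzkin_of Leaf = []"
| "motzkin_of (Left t) = None # motzkin_of t"
| "motzkin_of (Right t) = Some F # motzkin_of t"
| "motzkin_of (Bin s t) = Some U # motzkin_of s @ Some D # motzkin_of t"

abbreviation rise_opt :: "step option \<Rightarrow> int" where
  "rise_opt \<equiv> case_option 0 rise"

lemma rise_ge: "-1 \<le> rise x"
  by (cases x) auto

lemma rise_eq_minus_1_iff: "rise x = -1 \<longleftrightarrow> x = D"
  by (cases x) auto

lemma rise_opt_ge: "-1 \<le> rise_opt x"
  by (cases x) (auto simp: rise_ge)

lemma rise_opt_eq_minus_1_iff: "rise_opt x = -1 \<longleftrightarrow> x = Some D"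
  by (cases x) (auto simp: rise_eq_minus_1_iff)

section \<open>Trees as nonempty Dyck paths\<close>

lemma dyck_of_starts: "\<exists>w. dyck_of t = U # w"
  by (cases t) auto

lemma dyck_of_ends: "\<exists>w. dyck_of t = w @ [D]"
proof (induction t)
  case Leaf
  show ?case by (rule exI[of _ "[U]"]) simp
next
  case (Left t)
  then obtain w where "dyck_of t = w @ [D]" by blast
  then show ?case by (intro exI[of _ "U # D # w"]) simp
next
  case (Right t)
  show ?case by (rule exI[of _ "U # dyck_of t"]) simp
next
  case (Bin s t)
  then obtain w where "dyck_of t = w @ [D]" by blast
  then show ?case by (intro exI[of _ "U # dyck_of s @ D # w"]) simp
qed

lemma balanced_dyck_of: "balanced rise (dyck_of t)"
proof (induction t)
  case Leaf
  show ?case by (simp add: balanced_def)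
next
  case (Left t)
  then show ?case using balanced_first_return[of rise "[]" "dyck_of t" U D] by simp
next
  case (Right t)
  then show ?case using balanced_first_return[of rise "dyck_of t" "[]" U D] by simp
next
  case (Bin s t)
  then show ?case by (simp add: balanced_first_return)
qed

lemma length_dyck_of: "length (dyck_of t) = 2 * nodes t"
  by (induction t) auto

lemma F_notin_dyck_of: "F \<notin> set (dyck_of t)"
  by (induction t) auto

text \<open>Strong induction on length: the first letter must be \<open>U\<close>, and both parts of
  the first-return decomposition are shorter, hence empty or already encoded.\<close>

lemma dyck_of_surj:
  assumes "balanced rise w" "F \<notin> set w" "w \<noteq> []"
  shows "\<exists>t. dyck_of t = w"
  using assms
proof (induction w rule: length_induct)
  case (1 w)
  then obtain x v where w: "w = x # v" by (cases w) auto
  have x: "x = U"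
    using 1(2,3) w by (cases x) (auto simp: balanced_def dest: stays_from_nonneg)
  obtain A d B where "v = A @ d # B" "rise d = -1" and AB: "balanced rise A" "balanced rise B"
    by (rule balanced_first_return_exists[of rise U v, OF rise_ge]) (use 1(2) w x in auto)
  then have v: "v = A @ D # B" by (simp add: rise_eq_minus_1_iff)
  have IH: "\<exists>t. dyck_of t = A" if "A \<noteq> []"
    using 1 that w v AB by auto
  have IH': "\<exists>t. dyck_of t = B" if "B \<noteq> []"
    using 1 that w v AB by auto
  have "w = U # A @ D # B" using w x v by simp
  then consider "w = [U, D]" | t where "w = U # D # dyck_of t" | s where "w = U # dyck_of s @ [D]"
    | s t where "w = U # dyck_of s @ D # dyck_of t"
    using IH IH' by (metis append_Nil)
  then show ?case
    by cases (metis dyck_of.simps)+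
qed

lemma inj_dyck_of: "inj dyck_of"
proof (rule injI)
  fix t t'
  have first_return: "A @ D # B = A' @ D # B' \<longleftrightarrow> A = A' \<and> B = B'"
    if "balanced rise A" "balanced rise A'" for A A' B B'
    using first_return_eq_iff[of rise A A' D B B'] that by simp
  \<comment> \<open>These facts separate different constructors: a \<open>D\<close> directly after
    the initial \<open>U\<close> means that the first part is empty, and no code of a tree is
    empty.\<close>
  have nonempty: "dyck_of t \<noteq> []" "[] \<noteq> dyck_of t" "D # w \<noteq> dyck_of t @ v" "dyck_of t @ v \<noteq> D # w" for t v w
    using dyck_of_starts[of t] by auto
  show "dyck_of t = dyck_of t' \<Longrightarrow> t = t'"
  proof (induction t arbitrary: t')
    case Leaf
    then show ?case by (cases t') (auto simp: nonempty)
  next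
    case (Left t)
    then show ?case by (cases t') (auto simp: nonempty)
  next
    case (Right t)
    then show ?case by (cases t') (auto simp: nonempty first_return balanced_dyck_of)
  next
    case (Bin s t)
    then show ?case by (cases t') (auto simp: nonempty first_return balanced_dyck_of)
  qed
qed

section \<open>Trees as Motzkin words with two colours of flatsteps\<close>

lemma balanced_motzkin_of: "balanced rise_opt (motzkin_of t)"
  by (induction t) (auto simp: balanced_Cons_flat balanced_first_return)

text \<open>Unary nodes give one letter, \<open>Bin\<close> nodes two and leaves none; since there
  is one more leaf than \<open>Bin\<close> nodes, the word is one letter shorter than the number of
  nodes.\<close>

lemma Suc_length_motzkin_of: "Suc (length (motzkin_of t)) = nodes t"
  by (induction t) auto

text \<open>The empty word is a leaf; otherwise the first letter selects the constructor,
  \<open>Some D\<close> being excluded because it would lead below 0.\<close>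

lemma motzkin_of_surj:
  assumes "balanced rise_opt w"
  shows "\<exists>t. motzkin_of t = w"
  using assms
proof (induction w rule: length_induct)
  case (1 w)
  show ?case
  proof (cases w)
    case Nil
    then show ?thesis by (metis motzkin_of.simps(1))
  next
    case (Cons x v)
    have "x \<noteq> Some D"
      using 1(2) Cons by (auto simp: balanced_def dest: stays_from_nonneg)
    then consider "x = None" | "x = Some F" | "x = Some U"
      by (metis option.exhaust step.exhaust)
    then show ?thesis
    proof cases
      case 1
      then show ?thesis using "1.IH" "1.prems" Cons
        by (metis balanced_Cons_flat length_Cons lessI motzkin_of.simps(2) option.simps(4))
    next
      case 2
      then show ?thesis using "1.IH" "1.prems" Cons
        by (metis balanced_Cons_flat length_Cons lessI motzkin_of.simps(3) option.simps(5) rise.simps(2))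
    next
      case 3
      obtain A d B where "v = A @ d # B" "rise_opt d = -1"
        and AB: "balanced rise_opt A" "balanced rise_opt B"
        by (rule balanced_first_return_exists[of rise_opt x v, OF rise_opt_ge])
          (use "1.prems" Cons 3 in auto)
      then have v: "v = A @ Some D # B" by (simp add: rise_opt_eq_minus_1_iff)
      obtain s t where "motzkin_of s = A" "motzkin_of t = B"
        using "1.IH" AB Cons v by (metis length_Cons length_append less_Suc_eq less_add_Suc1 less_add_Suc2 add_Suc_right)
      then show ?thesis using Cons v 3 by (metis motzkin_of.simps(4))
    qed
  qed
qed

lemma inj_motzkin_of: "inj motzkin_of"
proof (rule injI)
  fix t t'
  have first_return: "A @ Some D # B = A' @ Some D # B' \<longleftrightarrow> A = A' \<and> B = B'"
    if "balanced rise_opt A" "balanced rise_opt A'" for A A' B B'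
    using first_return_eq_iff[of rise_opt A A' "Some D" B B'] that by simp
  show "motzkin_of t = motzkin_of t' \<Longrightarrow> t = t'"
  proof (induction t arbitrary: t')
    case Leaf
    then show ?case by (cases t') auto
  next
    case (Left t)
    then show ?case by (cases t') auto
  next
    case (Right t)
    then show ?case by (cases t') auto
  next
    case (Bin s t)
    then show ?case by (cases t') (auto simp: first_return balanced_motzkin_of)
  qed
qed

lemma count_None_motzkin_of: "count_list (motzkin_of t) None = lefts t"
  by (induction t) auto

lemma count_U_motzkin_of: "count_list (motzkin_of t) (Some U) = bins t"
  by (induction t) auto

section \<open>Occurrences of UDU and DDU\<close>

lemma occurrences_Nil: "p \<noteq> [] \<Longrightarrow> occurrences p [] = 0"
  by (simp add: occurrences_def)

text \<open>Position 0 is treated separately; all other positions are those of \<open>w\<close>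
  shifted by one.\<close>

lemma occurrences_Cons:
  assumes "p \<noteq> []"
  shows "occurrences p (x # w) = of_bool (take (length p) (x # w) = p) + occurrences p w"
proof -
  let ?S = "\<lambda>w. {i. i + length p \<le> length w \<and> take (length p) (drop i w) = p}"
  let ?Z = "if take (length p) (x # w) = p then {0 :: nat} else {}"
  have fin: "finite (?S w)"
    by (rule finite_subset[of _ "{..length w}"]) auto
  \<comment> \<open>\<open>take\<close> may return fewer letters near the end of the word; equality
    with \<open>p\<close> rules this out.\<close>
  have "length p \<le> length (x # w)" if "take (length p) (x # w) = p"
    using that by (metis length_take min.cobounded1)
  then have "i \<in> ?S (x # w) \<longleftrightarrow> i \<in> ?Z \<union> Suc ` ?S w" for i
    by (cases i) (auto simp: image_iff)
  then have "?S (x # w) = ?Z \<union> Suc ` ?S w"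
    by blast
  moreover have "card (?Z \<union> Suc ` ?S w) = card ?Z + card (Suc ` ?S w)"
    using fin by (intro card_Un_disjoint) auto
  ultimately show ?thesis by (simp add: occurrences_def card_image)
qed

text \<open>An occurrence of \<open>UDU\<close> neither contains two adjacent \<open>D\<close>s nor
  starts with \<open>D\<close>, so it lies within \<open>A @ [D]\<close> or within
  \<open>B\<close>.\<close>

lemma occurrences_UDU_append:
  "occurrences [U, D, U] (A @ D # D # B) = occurrences [U, D, U] (A @ [D]) + occurrences [U, D, U] B"
proof (induction A)
  case Nil
  show ?case by (simp add: occurrences_Nil occurrences_Cons)
next
  case (Cons x A)
  have "take 3 (x # A @ D # D # B) = [U, D, U] \<longleftrightarrow> take 3 (x # A @ [D]) = [U, D, U]"
    by (cases A; cases "tl A") (auto simp: numeral_3_eq_3)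
  then show ?case using Cons by (simp add: occurrences_Cons numeral_3_eq_3)
qed

text \<open>An occurrence starting in \<open>A\<close> cannot reach the second \<open>D\<close>, for
  it would then end in \<open>D\<close>; all others start at the first \<open>D\<close> or
  later.\<close>

lemma occurrences_DDU_append:
  "occurrences [D, D, U] (A @ D # D # B) =
     occurrences [D, D, U] (A @ [D]) + occurrences [D, D, U] (D # D # B)"
proof (induction A)
  case Nil
  show ?case by (simp add: occurrences_Nil occurrences_Cons)
next
  case (Cons x A)
  \<comment> \<open>The two windows differ only when \<open>A\<close> is empty, and then neither
    equals the pattern.\<close>
  have "take 3 (x # A @ D # D # B) = [D, D, U] \<longleftrightarrow> take 3 (x # A @ [D]) = [D, D, U]"
    by (cases A; cases "tl A") (auto simp: numeral_3_eq_3)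
  then show ?case using Cons by (simp add: occurrences_Cons numeral_3_eq_3)
qed

text \<open>The initial \<open>U\<close> is followed by another \<open>U\<close> and starts no
  occurrence; the final \<open>D\<close> of \<open>dyck_of s\<close> and the returning
  \<open>D\<close> form the pair at which the word splits.\<close>

lemma occurrences_UDU_first_return:
  "occurrences [U, D, U] (U # dyck_of s @ D # B) =
     occurrences [U, D, U] (dyck_of s) + occurrences [U, D, U] B"
proof -
  obtain v w where v: "dyck_of s = U # v" and w: "dyck_of s = w @ [D]"
    using dyck_of_starts dyck_of_ends by meson
  have "occurrences [U, D, U] (U # dyck_of s @ D # B) = occurrences [U, D, U] (dyck_of s @ D # B)"
    by (subst occurrences_Cons) (simp_all add: v)
  then show ?thesis
    using occurrences_UDU_append[of w B] by (simp add: w)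
qed

text \<open>The two \<open>D\<close>s are kept in front of \<open>B\<close>, because they complete
  an occurrence exactly when \<open>B\<close> begins with \<open>U\<close>.\<close>

lemma occurrences_DDU_first_return:
  "occurrences [D, D, U] (U # dyck_of s @ D # B) =
     occurrences [D, D, U] (dyck_of s) + occurrences [D, D, U] (D # D # B)"
proof -
  obtain w where "dyck_of s = w @ [D]"
    using dyck_of_ends by meson
  then show ?thesis
    using occurrences_DDU_append[of w B] occurrences_Cons[of "[D, D, U]" U "dyck_of s @ D # B"]
    by simp
qed

lemma occurrences_UDU_dyck_of: "occurrences [U, D, U] (dyck_of t) = lefts t"
proof (induction t)
  case Leaf
  show ?case by (simp add: occurrences_Nil occurrences_Cons)
next
  case (Left t)
  then show ?case using dyck_of_starts[of t] by (auto simp: occurrences_Cons)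
next
  case (Right t)
  then show ?case by (simp add: occurrences_UDU_first_return occurrences_Nil)
next
  case (Bin s t)
  then show ?case by (simp add: occurrences_UDU_first_return)
qed

lemma occurrences_DDU_dyck_of: "occurrences [D, D, U] (dyck_of t) = bins t"
proof (induction t)
  case Leaf
  show ?case by (simp add: occurrences_Nil occurrences_Cons)
next
  case (Left t)
  then show ?case using dyck_of_starts[of t] by (auto simp: occurrences_Cons)
next
  case (Right t)
  then show ?case by (simp add: occurrences_DDU_first_return occurrences_Nil occurrences_Cons)
next
  case (Bin s t)
  then show ?case using dyck_of_starts[of t]
    by (auto simp: occurrences_DDU_first_return occurrences_Cons)
qed

section \<open>Transfer of the counts from Dyck paths to coloured Motzkin words\<close>

lemma bij_betw_dyck_of:
  assumes "n \<ge> 1"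
  shows "bij_betw dyck_of {t. nodes t = n \<and> P (dyck_of t)} {w. dyck_path n w \<and> P w}"
proof -
  have "w \<in> dyck_of ` {t. nodes t = n \<and> P (dyck_of t)}" if w: "dyck_path n w" "P w" for w
  proof -
    have "w \<noteq> []" using w assms by (auto simp: dyck_path_iff)
    then obtain t where "dyck_of t = w"
      using dyck_of_surj w by (auto simp: dyck_path_iff)
    then show ?thesis using w length_dyck_of[of t] by (auto simp: dyck_path_iff)
  qed
  then show ?thesis
    by (auto simp: bij_betw_def dyck_path_iff balanced_dyck_of length_dyck_of F_notin_dyck_of
        intro: inj_on_subset[OF inj_dyck_of])
qed

lemma bij_betw_motzkin_of:
  assumes "n \<ge> 1"
  shows "bij_betw motzkin_of {t. nodes t = n \<and> P (motzkin_of t)}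
    {w. length w = n - 1 \<and> balanced rise_opt w \<and> P w}"
proof -
  have len: "nodes t = n \<longleftrightarrow> length (motzkin_of t) = n - 1" for t
    using Suc_length_motzkin_of[of t] assms by auto
  have "w \<in> motzkin_of ` {t. nodes t = n \<and> P (motzkin_of t)}"
    if w: "length w = n - 1" "balanced rise_opt w" "P w" for w
    using motzkin_of_surj[OF w(2)] w by (auto simp: len)
  then show ?thesis
    by (auto simp: bij_betw_def len balanced_motzkin_of intro: inj_on_subset[OF inj_motzkin_of])
qed

lemma card_dyck_UDU:
  assumes "n \<ge> 1"
  shows "card {w. dyck_path n w \<and> occurrences [U, D, U] w = k} =
    card {w. length w = n - 1 \<and> balanced rise_opt w \<and> count_list w None = k}"
  using bij_betw_same_card[OF bij_betw_dyck_of[OF assms, of "\<lambda>w. occurrences [U, D, U] w = k"]]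
    bij_betw_same_card[OF bij_betw_motzkin_of[OF assms, of "\<lambda>w. count_list w None = k"]]
  by (simp add: occurrences_UDU_dyck_of count_None_motzkin_of)

lemma card_dyck_DDU:
  assumes "n \<ge> 1"
  shows "card {w. dyck_path n w \<and> occurrences [D, D, U] w = k} =
    card {w. length w = n - 1 \<and> balanced rise_opt w \<and> count_list w (Some U) = k}"
  using bij_betw_same_card[OF bij_betw_dyck_of[OF assms, of "\<lambda>w. occurrences [D, D, U] w = k"]]
    bij_betw_same_card[OF bij_betw_motzkin_of[OF assms, of "\<lambda>w. count_list w (Some U) = k"]]
  by (simp add: occurrences_DDU_dyck_of count_U_motzkin_of)

section \<open>Words with prescribed subword\<close>

text \<open>Case distinction on whether the first letter is erased by the filter or is the first
  letter of \<open>v\<close>.\<close>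

lemma words_with_filter_Suc:
  "{w. length w = Suc n \<and> filter P w = v} =
    case_prod (#) ` ({x. \<not> P x} \<times> {w. length w = n \<and> filter P w = v}) \<union>
    (case v of [] \<Rightarrow> {} | y # v' \<Rightarrow> if P y then (#) y ` {w. length w = n \<and> filter P w = v'} else {})"
  (is "?L = ?R")
proof -
  have "w \<in> ?L \<longleftrightarrow> w \<in> ?R" for w
    by (cases w) (auto simp: image_iff split: list.splits if_splits)
  then show ?thesis by blast
qed

text \<open>Choose the positions that carry \<open>v\<close> and fill the others freely with erased
  letters. The induction on \<open>n\<close> is Pascal's rule; finiteness is carried along for the
  cardinality of the union.\<close>

lemma finite_card_words_with_filter:
  assumes "finite {x. \<not> P x}" "list_all P v"
  shows "finite {w. length w = n \<and> filter P w = v} \<and>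
    card {w. length w = n \<and> filter P w = v} =
      (n choose length v) * card {x. \<not> P x} ^ (n - length v)"
  using assms(2)
proof (induction n arbitrary: v)
  case 0
  have "{w. length w = 0 \<and> filter P w = v} = (if v = [] then {[]} else {})" by auto
  then show ?case by simp
next
  case (Suc n)
  let ?W = "\<lambda>n v. {w. length w = n \<and> filter P w = v}" and ?c = "card {x. \<not> P x}"
  have inj: "inj_on (case_prod (#)) S" for S :: "('a \<times> 'a list) set"
    by (auto simp: inj_on_def)
  have fin: "finite (?W n v)" and card: "card (?W n v) = (n choose length v) * ?c ^ (n - length v)"
    using Suc by auto
  have fin1: "finite (case_prod (#) ` ({x. \<not> P x} \<times> ?W n v))"
    using fin assms(1) by auto
  have card1: "card (case_prod (#) ` ({x. \<not> P x} \<times> ?W n v)) = ?c * card (?W n v)"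
    by (simp add: card_image[OF inj] card_cartesian_product)
  show ?case
  proof (cases v)
    case Nil
    then show ?thesis using fin1 card1 card by (simp add: words_with_filter_Suc)
  next
    case (Cons y v')
    then have y: "P y" and v': "list_all P v'" using Suc.prems by auto
    have fin2: "finite (?W n v')"
      and card2: "card (?W n v') = (n choose length v') * ?c ^ (n - length v')"
      using Suc.IH[OF v'] by auto
    have eq: "?W (Suc n) v = case_prod (#) ` ({x. \<not> P x} \<times> ?W n v) \<union> (#) y ` ?W n v'"
      using y Cons by (subst words_with_filter_Suc) simp
    have "card (?W (Suc n) v) = ?c * card (?W n v) + card (?W n v')"
      unfolding eq using fin1 fin2 y
      by (subst card_Un_disjoint) (auto simp: card1 card_image)
    also have "\<dots> = (Suc n choose length v) * ?c ^ (Suc n - length v)"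
    proof (cases "length v \<le> n")
      case True
      then have "n - length v' = Suc (n - length v)" using Cons by simp
      then show ?thesis using Cons unfolding card card2 by (simp add: algebra_simps)
    next
      \<comment> \<open>Here \<open>n choose length v\<close> is 0, so only words starting with
        \<open>y\<close> can contribute.\<close>
      case False
      then show ?thesis using Cons unfolding card card2 by (simp add: binomial_eq_0)
    qed
    finally show ?thesis using eq fin1 fin2 by simp
  qed
qed

lemma card_words_with_filter_in:
  assumes "finite {x. \<not> P x}" "finite V" "\<And>v. v \<in> V \<Longrightarrow> list_all P v \<and> length v = l"
  shows "card {w. length w = n \<and> filter P w \<in> V} =
    (n choose l) * card {x. \<not> P x} ^ (n - l) * card V"
proof -
  have "{w. length w = n \<and> filter P w \<in> V} = (\<Union>v\<in>V. {w. length w = n \<and> filter P w = v})"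
    by auto
  also have "card \<dots> = (\<Sum>v\<in>V. card {w. length w = n \<and> filter P w = v})"
    using assms finite_card_words_with_filter[OF assms(1)] by (intro card_UN_disjoint) auto
  also have "\<dots> = (\<Sum>v\<in>V. (n choose l) * card {x. \<not> P x} ^ (n - l))"
    using assms finite_card_words_with_filter[OF assms(1)] by (intro sum.cong) auto
  finally show ?thesis by simp
qed

section \<open>Motzkin words with a given number of coloured flatsteps or upsteps\<close>

lemma finite_motzkin_paths: "finite {w. motzkin_path n w}"
proof -
  have "finite {w :: step list. set w \<subseteq> {U, F, D} \<and> length w = n}"
    by (intro finite_lists_length_eq) simp
  then show ?thesis
    by (rule rev_finite_subset) (auto simp: motzkin_path_def intro: step.exhaust)
qed

lemma map_Some_map_the: "None \<notin> set w \<Longrightarrow> map Some (map the w) = w"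
  by (induction w) auto

lemma image_map_Some:
  "w \<in> map Some ` S \<longleftrightarrow> None \<notin> set w \<and> map the w \<in> S"
proof
  assume w: "None \<notin> set w \<and> map the w \<in> S"
  then have "map Some (map the w) = w" by (blast intro: map_Some_map_the)
  then show "w \<in> map Some ` S" using w by (metis imageI)
qed auto

lemma card_image_map_Some: "card (map Some ` S) = card S"
  by (intro card_image inj_onI) (simp add: inj_map_eq_map)

lemma balanced_map_the:
  assumes "None \<notin> set w"
  shows "balanced rise (map the w) \<longleftrightarrow> balanced rise_opt w"
proof -
  have "map Some (map the w) = w" using assms by (rule map_Some_map_the)
  moreover have "balanced rise_opt (map Some (map the w)) \<longleftrightarrow> balanced rise (map the w)"
    unfolding balanced_map[of rise_opt] by (simp add: comp_def)
  ultimately show ?thesis by simp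
qed

text \<open>Erasing every \<open>None\<close> leaves an arbitrary Motzkin path of length
  \<open>m - k\<close>. Only one letter is erased, so the power counting the fillings is 1.\<close>

lemma card_balanced_None:
  "card {w. length w = m \<and> balanced rise_opt w \<and> count_list w None = k} =
    (m choose k) * motzkin_number (int m - int k)"
proof (cases "k \<le> m")
  case False
  have "count_list w None \<noteq> k" if "length w = m" for w :: "step option list"
    using False that count_le_length[of w None] by linarith
  then have "{w. length w = m \<and> balanced rise_opt w \<and> count_list w None = k} = {}"
    by blast
  then show ?thesis using False by (simp only:) (simp add: binomial_eq_0)
next
  case True
  let ?P = "\<lambda>x :: step option. x \<noteq> None"
  let ?V = "map Some ` {v. motzkin_path (m - k) v}"
  have count: "length (filter ?P w) + count_list w None = length w" for w :: "step option list"
    by (induction w) auto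
  have bal: "balanced rise_opt (filter ?P w) \<longleftrightarrow> balanced rise_opt w" for w
    by (rule balanced_filter) simp
  have "{w. length w = m \<and> balanced rise_opt w \<and> count_list w None = k} =
      {w. length w = m \<and> filter ?P w \<in> ?V}" (is "?A = ?B")
  proof (intro set_eqI)
    fix w
    have "filter ?P w \<in> ?V \<longleftrightarrow> length (filter ?P w) = m - k \<and> balanced rise_opt w"
      using bal[of w] by (simp add: image_map_Some motzkin_path_iff balanced_map_the)
    moreover have "length (filter ?P w) = m - k \<longleftrightarrow> count_list w None = k" if "length w = m"
      using count[of w] that True by linarith
    ultimately show "w \<in> ?A \<longleftrightarrow> w \<in> ?B" by blast
  qed
  also have "card \<dots> = (m choose (m - k)) * card {x. \<not> ?P x} ^ (m - (m - k)) * card ?V"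
    by (rule card_words_with_filter_in)
      (auto simp: finite_motzkin_paths list_all_iff, simp add: motzkin_path_def)
  also have "\<dots> = (m choose k) * motzkin_number (int m - int k)"
  proof -
    have "nat (int m - int k) = m - k" by simp
    then have "card ?V = motzkin_number (int m - int k)"
      using True by (simp add: card_image_map_Some motzkin_number_def)
    then show ?thesis using binomial_symmetric[OF True] by simp
  qed
  finally show ?thesis .
qed

text \<open>Erasing all flatsteps leaves an arbitrary Dyck path; each erased position held one of
  two letters, whence the power of 2.\<close>

lemma card_balanced_Some_U:
  "card {w. length w = m \<and> balanced rise_opt w \<and> count_list w (Some U) = k} =
    (m choose (2 * k)) * 2 ^ (m - 2 * k) * card {w. dyck_path k w}"
proof -
  let ?P = "\<lambda>x. x = Some U \<or> x = Some D"
  let ?V = "map Some ` {v. dyck_path k v}"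
  have flat: "{x. \<not> ?P x} = {None, Some F}"
    by (auto intro: step.exhaust)
  have count: "length (filter ?P w) = count_list w (Some U) + count_list w (Some D)" for w
    by (induction w) auto
  have weight: "weight rise_opt w = int (count_list w (Some U)) - int (count_list w (Some D))" for w
  proof (induction w)
    case (Cons x w)
    then show ?case by (cases x; cases "the x") auto
  qed simp
  have bal: "balanced rise_opt (filter ?P w) \<longleftrightarrow> balanced rise_opt w" for w
  proof (rule balanced_filter)
    show "rise_opt x = 0" if "\<not> ?P x" for x
      using that by (cases x; cases "the x") auto
  qed
  have "{w. length w = m \<and> balanced rise_opt w \<and> count_list w (Some U) = k} =
      {w. length w = m \<and> filter ?P w \<in> ?V}" (is "?A = ?B")
  proof (intro set_eqI)
    fix w
    have "None \<notin> set (filter ?P w)" "F \<notin> set (map the (filter ?P w))" by auto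
    then have "filter ?P w \<in> ?V \<longleftrightarrow> length (filter ?P w) = 2 * k \<and> balanced rise_opt w"
      using bal[of w] balanced_map_the[of "filter ?P w"]
      by (simp only: image_map_Some dyck_path_iff mem_Collect_eq length_map simp_thms)
    \<comment> \<open>Balance forces as many downsteps as upsteps.\<close>
    moreover have "length (filter ?P w) = 2 * k \<longleftrightarrow> count_list w (Some U) = k"
      if "balanced rise_opt w"
      using count[of w] weight[of w] that unfolding balanced_def by linarith
    ultimately show "w \<in> ?A \<longleftrightarrow> w \<in> ?B" by blast
  qed
  also have "card \<dots> = (m choose (2 * k)) * card {x. \<not> ?P x} ^ (m - 2 * k) * card ?V"
  proof (rule card_words_with_filter_in)
    show "finite ?V"
      by (intro finite_imageI finite_subset[OF _ finite_motzkin_paths[of "2 * k"]])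
        (auto simp: dyck_path_def)
    have "x \<noteq> F \<longleftrightarrow> x = U \<or> x = D" for x by (cases x) auto
    then have "F \<notin> set w \<longleftrightarrow> (\<forall>x\<in>set w. x = U \<or> x = D)" for w by metis
    then show "list_all ?P v \<and> length v = 2 * k" if "v \<in> ?V" for v
      using that by (auto simp: dyck_path_iff list_all_iff)
  qed (simp only: flat finite.intros)
  also have "\<dots> = (m choose (2 * k)) * 2 ^ (m - 2 * k) * card {w. dyck_path k w}"
    unfolding flat card_image_map_Some by (simp add: numeral_2_eq_2)
  finally show ?thesis .
qed

section \<open>Ballot numbers\<close>

lemma length_eq_count_U_D: "F \<notin> set w \<Longrightarrow> length w = count_list w U + count_list w D"
proof (induction w)
  case (Cons x w)
  then show ?case by (cases x) auto
qed simp

text \<open>No return to height 0 is required, so that the set admits a recursion on the last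
  step.\<close>

definition ballot_words :: "nat \<Rightarrow> nat \<Rightarrow> step list set" where
  "ballot_words a d =
    {w. F \<notin> set w \<and> count_list w U = a \<and> count_list w D = d \<and> stays_from rise 0 w}"

lemma stays_from_rise_snoc:
  "stays_from rise 0 (w @ [x]) \<longleftrightarrow> stays_from rise 0 w \<and> 0 \<le> weight rise w + rise x"
  using stays_from_iff_take[of rise 0 w] by (auto simp: stays_from_append)

lemma ballot_words_eq_empty:
  assumes "a < d"
  shows "ballot_words a d = {}"
proof -
  have "int (count_list w D) \<le> int (count_list w U)" if "stays_from rise 0 w" for w
    using that[unfolded stays_from_iff_take] weight_rise[of w] by auto
  then show ?thesis using assms by (fastforce simp: ballot_words_def)
qed

lemma ballot_words_0: "ballot_words a 0 = {replicate a U}"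
proof -
  have "stays_from rise h (replicate a U)" if "0 \<le> h" for h
    using that by (induction a arbitrary: h) auto
  moreover have "w = replicate a U" if "F \<notin> set w" "count_list w U = a" "count_list w D = 0" for w
    using that
  proof (induction w arbitrary: a)
    case (Cons x w)
    then show ?case by (cases x) auto
  qed simp
  moreover have "count_list (replicate a U) x = (if x = U then a else 0)" for x
    by (induction a) auto
  ultimately show ?thesis by (auto simp: ballot_words_def)
qed

text \<open>Remove the last letter. By \<open>d \<le> a\<close> the final height is nonnegative in
  any case, so putting a letter back imposes no condition.\<close>

lemma ballot_words_Suc:
  assumes "d \<le> a"
  shows "ballot_words (Suc a) (Suc d) =
    (\<lambda>w. w @ [U]) ` ballot_words a (Suc d) \<union> (\<lambda>w. w @ [D]) ` ballot_words (Suc a) d"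
    (is "?L = ?R")
proof (intro set_eqI)
  fix w
  show "w \<in> ?L \<longleftrightarrow> w \<in> ?R"
  proof (cases w rule: rev_cases)
    case Nil
    then show ?thesis by (auto simp: ballot_words_def)
  next
    case (snoc v x)
    have "0 \<le> weight rise v" if "stays_from rise 0 v"
      using that stays_from_iff_take[of rise 0 v] by auto
    then show ?thesis using snoc assms
      by (cases x) (auto simp: ballot_words_def stays_from_rise_snoc image_iff weight_rise)
  qed
qed

lemma finite_ballot_words: "finite (ballot_words a d)"
proof -
  have "set w \<subseteq> {U, F, D}" for w
    using step.exhaust by auto
  moreover have "finite {w :: step list. set w \<subseteq> {U, F, D} \<and> length w = a + d}"
    by (intro finite_lists_length_eq) simp
  ultimately show ?thesis
    by (elim rev_finite_subset) (auto simp: ballot_words_def length_eq_count_U_D)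
qed

text \<open>The ballot number as a difference of two binomials, written additively to avoid
  subtraction on \<open>nat\<close>. Both sides satisfy Pascal's recursion.\<close>

lemma card_ballot_words:
  assumes "d \<le> a"
  shows "card (ballot_words a (Suc d)) + ((a + Suc d) choose d) = (a + Suc d) choose (Suc d)"
  using assms
proof (induction "a + d" arbitrary: a d rule: less_induct)
  case less
  show ?case
  proof (cases "a = d")
    case True
    \<comment> \<open>On the boundary the set is empty and the two binomials agree by
      symmetry.\<close>
    then show ?thesis
      using binomial_symmetric[of d "a + Suc d"] by (simp add: ballot_words_eq_empty)
  next
    case False
    then obtain b where a: "a = Suc b" "d \<le> b" using less.prems by (cases a) auto
    have "card (ballot_words a (Suc d)) = card (ballot_words b (Suc d)) + card (ballot_words a d)"
      unfolding a(1) ballot_words_Suc[OF a(2)]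
      by (subst card_Un_disjoint) (auto simp: finite_ballot_words card_image inj_on_def)
    moreover have "card (ballot_words b (Suc d)) + ((b + Suc d) choose d) = (b + Suc d) choose (Suc d)"
      using less.hyps[of b d] a by simp
    \<comment> \<open>For \<open>d = 0\<close> there is no binomial to subtract: the only word is
      all \<open>U\<close>s.\<close>
    moreover have "card (ballot_words a d) + (if d = 0 then 0 else (a + d) choose (d - 1)) = (a + d) choose d"
      using less.hyps[of a "d - 1"] less.prems by (cases d) (auto simp: ballot_words_0)
    ultimately show ?thesis using a by (cases d) auto
  qed
qed

lemma card_dyck_paths: "card {w. dyck_path k w} = catalan k"
proof -
  have "{w. dyck_path k w} = ballot_words k k"
    by (auto simp: dyck_path_iff ballot_words_def balanced_def weight_rise length_eq_count_U_D)
  moreover have "(k + 1) * card (ballot_words k k) = (2 * k) choose k"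
  proof (cases k)
    case 0
    then show ?thesis by (simp add: ballot_words_0)
  next
    case (Suc j)
    have "Suc j * ((2 * k) choose Suc j) = (2 * k - j) * ((2 * k) choose j)"
      by (simp only: binomial_absorb_comp binomial_absorption)
    \<comment> \<open>Since \<open>k = Suc j\<close>, the factor \<open>2 * k - j\<close> is
      \<open>k + 1\<close>.\<close>
    then have "k * ((2 * k) choose k) = (k + 1) * ((2 * k) choose j)"
      using Suc by simp
    moreover have "card (ballot_words k k) + ((2 * k) choose j) = (2 * k) choose k"
      using card_ballot_words[of j k] Suc by (simp add: mult_2)
    then have "(k + 1) * card (ballot_words k k) + (k + 1) * ((2 * k) choose j)
        = (k + 1) * ((2 * k) choose k)"
      by (metis distrib_left)
    ultimately show ?thesis by simp
  qed
  then have "(k + 1) * card (ballot_words k k) = (k + 1) * catalan k"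
    by (simp only: Suc_times_catalan)
  then have "card (ballot_words k k) = catalan k"
    unfolding mult_cancel1 by simp
  ultimately show ?thesis by simp
qed

theorem theorem2:
  fixes n k :: nat
  assumes "n \<ge> 1"
  shows "(card {w. dyck_path n w \<and> occurrences [U, D, U] w = k}
           = ((n - 1) choose k) * motzkin_number (int n - 1 - int k)) \<and>
         (card {w. dyck_path n w \<and> occurrences [D, D, U] w = k}
           = ((n - 1) choose (2 * k)) * 2 ^ (n - 1 - 2 * k) * catalan k)"
proof -
  \<comment> \<open>This brings the argument of \<open>motzkin_number\<close> into the form
    \<open>int m - int k\<close> with \<open>m = n - 1\<close>.\<close>
  have "int n - 1 = int (n - 1)" using assms by simp
  then show ?thesis
    by (simp only: card_dyck_UDU[OF assms] card_dyck_DDU[OF assms] card_balanced_None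
        card_balanced_Some_U card_dyck_paths simp_thms)
qed

end
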